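(* Let $\Lambda:[0,1]\times\mathbb{R}^d\to\mathbb{R}^d$ be a continuous function and let $a,b>0$ and $c\ge0$ be constants such that, for all $q,\tilde q\in\mathbb{R}^d$, $$\sup_{\mu\in[0,1]}\|\Lambda(\mu,q)\|\le a\,e^{c\|q\|}$$ and $$\sup_{\mu\in[0,1]}\|\Lambda(\mu,q)-\Lambda(\mu,\tilde q)\|\le b\,e^{c\max(\|q\|,\|\tilde q\|)}\,\|q-\tilde q\|.$$ Let $q_0\in\mathbb{R}^d$ be such that either $c=0$ or $$2b<\exp\!\Big(-2c\big(\|q_0\|+a\,e^{c\|q_0\|}\big)\Big).$$ Then there exists a unique function $q:[0,1]\to\mathbb{R}^d$ such that $q(0)=q_0$ and, for all $\mu\in[0,1]$, $q'(\mu)=\Lambda(\mu,q(\mu))$. Furthermore, for all $\mu\in[0,1]$, $$\|q(\mu)-q_0\|\le\begin{cases}2\mu a\,e^{c\|q_0\|}&\text{if }c>0,\\ \mu a\,e^{b}&\text{if }c=0.\end{cases}$$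
   Context: $\|\cdot\|$ denotes the Euclidean norm on $\mathbb{R}^d$. *)

theory Defs
  imports "HOL-Analysis.Analysis"
begin

text \<open>A function with domain \<open>[0,1]\<close> is rendered as an element of \<open>{0..1} \<rightarrow>\<^sub>E UNIV\<close>, so
  that equality of such functions only concerns their values on \<open>[0,1]\<close>. The derivative within
  \<open>[0,1]\<close> is two-sided at interior points and one-sided at the endpoints.\<close>

definition solves_ivp ::
    "(real \<Rightarrow> real ^ 'd \<Rightarrow> real ^ 'd) \<Rightarrow> real ^ 'd \<Rightarrow> (real \<Rightarrow> real ^ 'd) \<Rightarrow> bool" where
  "solves_ivp \<Lambda> q0 q \<longleftrightarrow>
     q \<in> {0..1} \<rightarrow>\<^sub>E UNIV \<and> q 0 = q0 \<and>
     (\<forall>\<mu>\<in>{0..1}. (q has_vector_derivative \<Lambda> \<mu> (q \<mu>)) (at \<mu> within {0..1}))"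

end

theory Submission
  imports Defs
begin

text \<open>Put \<open>A = a * exp (c * norm q0)\<close>. On the ball of radius \<open>2 * A\<close> around \<open>q0\<close> the smallness
  condition makes \<open>\<Lambda>\<close> Lipschitz in \<open>q\<close> with constant at most \<open>1/2\<close>, so the norm of \<open>\<Lambda>\<close> is at most
  \<open>A + (1/2) * (2 * A) = 2 * A\<close> there: a solution of speed at most \<open>2 * A\<close> cannot leave the ball
  before time \<open>1\<close>. If \<open>c = 0\<close>, the speed is at most \<open>a\<close> everywhere and the ball of radius \<open>a\<close> serves
  the same purpose. Composing \<open>\<Lambda>\<close> with the nearest-point projection onto the ball reduces existence
  to the globally Lipschitz case.\<close>

text \<open>The mean value inequality with a scalar majorant \<open>\<phi>\<close>: an exponential
  \<open>\<phi>\<close> gives the weighted estimates, a linear one the bound on the distance from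
  the initial value.\<close>

lemma norm_increment_le:
  fixes u :: "real \<Rightarrow> 'a::real_normed_vector" and \<phi> :: "real \<Rightarrow> real"
  assumes u: "\<And>t. t \<in> {a..b} \<Longrightarrow> (u has_vector_derivative u' t) (at t within {a..b})"
    and \<phi>: "\<And>t. t \<in> {a..b} \<Longrightarrow> (\<phi> has_vector_derivative \<phi>' t) (at t within {a..b})"
    and le: "\<And>t. t \<in> {a..b} \<Longrightarrow> norm (u' t) \<le> \<phi>' t"
    and t: "t \<in> {a..b}"
  shows "norm (u t - u a) \<le> \<phi> t - \<phi> a"
proof (cases "t = a")
  case False
  show ?thesis
  proof (rule differentiable_bound_general)
    show "a < t" using False t by simp
    show "continuous_on {a..t} u" "continuous_on {a..t} \<phi>"
      using continuous_on_subset[OF continuous_on_vector_derivative[OF u], of "{a..t}"]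
        continuous_on_subset[OF continuous_on_vector_derivative[OF \<phi>], of "{a..t}"] t
      by auto
    fix s assume s: "a < s" "s < t"
    show "(u has_vector_derivative u' s) (at s)" "(\<phi> has_vector_derivative \<phi>' s) (at s)"
      using u[of s] \<phi>[of s] s t by (simp_all add: at_within_Icc_at)
    show "norm (u' s) \<le> \<phi>' s"
      using le[of s] s t by simp
  qed
qed simp

text \<open>The weight \<open>exp (2 * L * t)\<close> halves the Lipschitz constant of the Picard operator: it makes
  the operator a contraction on all of \<open>[0,T]\<close>, whatever \<open>L\<close> and \<open>T\<close> are.\<close>

lemma exp_weighted_increment_bound:
  fixes u v :: "real \<Rightarrow> 'a::real_normed_vector"
  assumes M: "M \<ge> 0"
    and u: "\<And>t. t \<in> {0..T} \<Longrightarrow> (u has_vector_derivative v t) (at t within {0..T})"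
    and v: "\<And>t. t \<in> {0..T} \<Longrightarrow> norm (v t) \<le> L * (exp (2 * L * t) * M)"
    and t: "t \<in> {0..T}"
  shows "norm (u t - u 0) \<le> exp (2 * L * t) * (M / 2)"
proof -
  have "norm (u t - u 0) \<le> exp (2 * L * t) * (M / 2) - exp (2 * L * 0) * (M / 2)"
  proof (rule norm_increment_le[OF u _ v t])
    show "((\<lambda>t. exp (2 * L * t) * (M / 2)) has_vector_derivative L * (exp (2 * L * s) * M))
        (at s within {0..T})" for s
      unfolding has_real_derivative_iff_has_vector_derivative[symmetric]
      by (auto intro!: derivative_eq_intros)
  qed
  with M show ?thesis by simp
qed

text \<open>The maximum of the weighted distance is at most half of itself, hence zero. The
  Lipschitz estimate is asked for only along the two solutions, so a local constant will do.\<close>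

lemma ivp_unique:
  fixes x y :: "real \<Rightarrow> 'a::real_normed_vector"
  assumes L: "L > 0"
    and x: "\<And>t. t \<in> {0..T} \<Longrightarrow> (x has_vector_derivative F t (x t)) (at t within {0..T})"
    and y: "\<And>t. t \<in> {0..T} \<Longrightarrow> (y has_vector_derivative F t (y t)) (at t within {0..T})"
    and lip: "\<And>t. t \<in> {0..T} \<Longrightarrow> norm (F t (x t) - F t (y t)) \<le> L * norm (x t - y t)"
    and init: "x 0 = y 0" and t: "t \<in> {0..T}"
  shows "x t = y t"
proof -
  define w where "w s = exp (- (2 * L * s)) * norm (x s - y s)" for s
  have "continuous_on {0..T} w"
    unfolding w_def
    by (intro continuous_intros continuous_on_vector_derivative[OF x]
        continuous_on_vector_derivative[OF y]) auto
  then obtain m where m: "m \<in> {0..T}" "\<And>s. s \<in> {0..T} \<Longrightarrow> w s \<le> w m"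
    using continuous_attains_sup[of "{0..T}" w] t by auto
  have dist: "norm (x s - y s) = exp (2 * L * s) * w s" for s
    by (simp add: w_def exp_minus)
  have "norm ((x m - y m) - (x 0 - y 0)) \<le> exp (2 * L * m) * (w m / 2)"
  proof (rule exp_weighted_increment_bound)
    show "w m \<ge> 0" by (simp add: w_def)
    fix s assume s: "s \<in> {0..T}"
    show "((\<lambda>s. x s - y s) has_vector_derivative F s (x s) - F s (y s)) (at s within {0..T})"
      using x[OF s] y[OF s] by (rule has_vector_derivative_diff)
    show "norm (F s (x s) - F s (y s)) \<le> L * (exp (2 * L * s) * w m)"
      using lip[OF s] m(2)[OF s] L unfolding dist
      by (meson exp_ge_zero less_imp_le mult_left_mono order_trans)
  qed (use m in auto)
  then have "w m \<le> 0" by (simp add: init dist)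
  with m(2)[OF t] have "w t \<le> 0" by simp
  then show ?thesis by (simp add: w_def mult_le_0_iff)
qed

text \<open>Banach's fixed point theorem for the Picard operator. The unknown \<open>u\<close> is
  the solution divided by \<open>exp (2 * L * t)\<close>, so that the plain supremum distance of
  such functions acts as the weighted distance.\<close>

lemma ivp_exists_lipschitz:
  fixes F :: "real \<Rightarrow> 'a::banach \<Rightarrow> 'a"
  assumes L: "L > 0" and T: "T \<ge> 0"
    and cont: "continuous_on ({0..T} \<times> UNIV) (\<lambda>(t, x). F t x)"
    and lip: "\<And>t x y. t \<in> {0..T} \<Longrightarrow> norm (F t x - F t y) \<le> L * norm (x - y)"
  obtains x where "x 0 = x0"
    and "\<And>t. t \<in> {0..T} \<Longrightarrow> (x has_vector_derivative F t (x t)) (at t within {0..T})"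
proof -
  let ?e = "\<lambda>t. exp (2 * L * t)"
  define P where "P u t = x0 + integral {0..t} (\<lambda>s. F s (?e s *\<^sub>R u s))"
    for u :: "real \<Rightarrow>\<^sub>C 'a" and t
  have contF: "continuous_on {0..T} (\<lambda>s. F s (?e s *\<^sub>R u s))" for u :: "real \<Rightarrow>\<^sub>C 'a"
  proof -
    have "continuous_on {0..T} (\<lambda>s. (s, ?e s *\<^sub>R u s))"
      by (intro continuous_intros continuous_on_apply_bcontfun)
    from continuous_on_compose2[OF cont this] show ?thesis by auto
  qed
  have P: "(P u has_vector_derivative F t (?e t *\<^sub>R u t)) (at t within {0..T})"
    if "t \<in> {0..T}" for u t
    unfolding P_def
    using integral_has_vector_derivative[OF contF that]
    by (auto intro!: derivative_eq_intros)
  \<comment> \<open>Bounded continuous functions live on the whole line: \<open>clamp\<close>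
    extends the rescaled \<open>P u\<close> by constants outside \<open>[0,T]\<close>.\<close>
  have "\<exists>g :: real \<Rightarrow>\<^sub>C 'a. \<forall>t. g t = exp (- (2 * L * clamp 0 T t)) *\<^sub>R P u (clamp 0 T t)" for u
    by (rule continuous_on_cbox_bcontfunE[of 0 T "\<lambda>t. exp (- (2 * L * t)) *\<^sub>R P u t"])
      (auto intro!: continuous_intros continuous_on_vector_derivative[OF P])
  then obtain S :: "(real \<Rightarrow>\<^sub>C 'a) \<Rightarrow> (real \<Rightarrow>\<^sub>C 'a)" where
    S: "\<And>u t. S u t = exp (- (2 * L * clamp 0 T t)) *\<^sub>R P u (clamp 0 T t)"
    by metis
  have "dist (S u) (S w) \<le> 1 / 2 * dist u w" for u w
  proof (rule dist_bound)
    fix t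
    define r where "r = clamp 0 T t"
    have r: "r \<in> {0..T}"
      using clamp_in_interval[of 0 T t] T by (simp add: r_def)
    have "norm ((P u r - P w r) - (P u 0 - P w 0)) \<le> ?e r * (dist u w / 2)"
    proof (rule exp_weighted_increment_bound[OF zero_le_dist])
      fix s assume s: "s \<in> {0..T}"
      show "((\<lambda>s. P u s - P w s) has_vector_derivative
          F s (?e s *\<^sub>R u s) - F s (?e s *\<^sub>R w s)) (at s within {0..T})"
        using P[OF s] P[OF s] by (rule has_vector_derivative_diff)
      have "norm (F s (?e s *\<^sub>R u s) - F s (?e s *\<^sub>R w s)) \<le> L * (?e s * dist (u s) (w s))"
        using lip[OF s, of "?e s *\<^sub>R u s" "?e s *\<^sub>R w s"]
        by (simp add: dist_norm flip: scaleR_diff_right)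
      also have "\<dots> \<le> L * (?e s * dist u w)"
        using L dist_bounded[of u s w] by simp
      finally show "norm (F s (?e s *\<^sub>R u s) - F s (?e s *\<^sub>R w s)) \<le> L * (?e s * dist u w)" .
    qed (use r in auto)
    then have "norm (P u r - P w r) \<le> ?e r * (dist u w / 2)"
      by (simp add: P_def)
    then have "exp (- (2 * L * r)) * norm (P u r - P w r) \<le> dist u w / 2"
      by (simp add: exp_minus field_simps)
    moreover have "S u t - S w t = exp (- (2 * L * r)) *\<^sub>R (P u r - P w r)"
      by (simp add: S r_def scaleR_diff_right)
    ultimately show "dist (S u t) (S w t) \<le> 1 / 2 * dist u w"
      by (simp add: dist_norm[of "S u t"])
  qed
  then obtain u where u: "S u = u"
    using banach_fix_type[of "1 / 2" S] by auto
  \<comment> \<open>Multiplying the fixed point equation by the weight turns the integrand of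
    \<open>P u\<close> into \<open>F s (P u s)\<close>, so \<open>P u\<close> is the
    solution.\<close>
  have fix_eq: "?e t *\<^sub>R u t = P u t" if "t \<in> {0..T}" for t
    using S[of u t] that clamp_cancel_cbox[of t 0 T] unfolding u
    by (simp add: exp_minus)
  show thesis
  proof
    show "P u 0 = x0" by (simp add: P_def)
    show "(P u has_vector_derivative F t (P u t)) (at t within {0..T})" if "t \<in> {0..T}" for t
      using P[OF that, of u] fix_eq[OF that] by simp
  qed
qed

text \<open>The radius \<open>T * B\<close> is the distance covered in time \<open>T\<close> at
  speed \<open>B\<close>. Hence the solution of the projected equation stays in the ball, where the
  projection is the identity.\<close>

lemma ivp_exists_ball:
  fixes F :: "real \<Rightarrow> 'a::euclidean_space \<Rightarrow> 'a"
  assumes L: "L > 0" and T: "T \<ge> 0" and B: "B \<ge> 0"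
    and cont: "continuous_on ({0..T} \<times> cball x0 (T * B)) (\<lambda>(t, x). F t x)"
    and lip: "\<And>t x y. t \<in> {0..T} \<Longrightarrow> x \<in> cball x0 (T * B) \<Longrightarrow> y \<in> cball x0 (T * B) \<Longrightarrow>
      norm (F t x - F t y) \<le> L * norm (x - y)"
    and bound: "\<And>t x. t \<in> {0..T} \<Longrightarrow> x \<in> cball x0 (T * B) \<Longrightarrow> norm (F t x) \<le> B"
  obtains x where "x 0 = x0"
    and "\<And>t. t \<in> {0..T} \<Longrightarrow> (x has_vector_derivative F t (x t)) (at t within {0..T})"
    and "\<And>t. t \<in> {0..T} \<Longrightarrow> norm (x t - x0) \<le> t * B"
proof -
  define D where "D = cball x0 (T * B)"
  define p where "p = closest_point D"
  have D: "convex D" "closed D" "D \<noteq> {}"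
    using mult_nonneg_nonneg[OF T B] by (auto simp: D_def)
  have p: "p x \<in> D" for x
    unfolding p_def using D by (intro closest_point_in_set)
  have contp: "continuous_on UNIV p"
    unfolding p_def using D by (rule continuous_on_closest_point)
  have "continuous_on ({0..T} \<times> UNIV) (\<lambda>z. (fst z, p (snd z)))"
    by (intro continuous_intros continuous_on_compose2[OF contp]) auto
  from continuous_on_compose2[OF cont[folded D_def] this]
  have "continuous_on ({0..T} \<times> UNIV) (\<lambda>(t, x). F t (p x))"
    using p by (simp add: case_prod_unfold image_subset_iff)
  moreover have "norm (F t (p x) - F t (p y)) \<le> L * norm (x - y)" if "t \<in> {0..T}" for t x y
  proof -
    have "norm (F t (p x) - F t (p y)) \<le> L * norm (p x - p y)"
      using lip[OF that] p by (simp add: D_def)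
    \<comment> \<open>Projection onto a closed convex set does not increase distances.\<close>
    also have "\<dots> \<le> L * norm (x - y)"
      using closest_point_lipschitz[OF D, of x y] L by (simp add: p_def dist_norm)
    finally show ?thesis .
  qed
  ultimately obtain x where x0: "x 0 = x0"
    and x: "\<And>t. t \<in> {0..T} \<Longrightarrow> (x has_vector_derivative F t (p (x t))) (at t within {0..T})"
    using ivp_exists_lipschitz[OF L T, of "\<lambda>t x. F t (p x)" x0] by blast
  \<comment> \<open>The speed bound applies before \<open>x t\<close> is known to lie in
    \<open>D\<close>, because \<open>p (x t)\<close> always does.\<close>
  have near: "norm (x t - x0) \<le> t * B" if t: "t \<in> {0..T}" for t
  proof -
    have "((\<lambda>t. t * B) has_vector_derivative B) (at s within {0..T})" for s
      unfolding has_real_derivative_iff_has_vector_derivative[symmetric]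
      by (auto intro!: derivative_eq_intros)
    from norm_increment_le[OF x this _ t] bound p x0 show ?thesis
      by (simp add: D_def)
  qed
  have "x t \<in> D" if t: "t \<in> {0..T}" for t
    using near[OF t] mult_right_mono[of t T B] t B by (simp add: D_def dist_norm norm_minus_commute)
  then have "p (x t) = x t" if t: "t \<in> {0..T}" for t
    using that by (simp add: p_def closest_point_self)
  with x x0 near that show thesis by metis
qed

theorem theoremG1:
  fixes \<Lambda> :: "real \<Rightarrow> real ^ 'd \<Rightarrow> real ^ 'd"
    and a b c :: real
    and q0 :: "real ^ 'd"
  assumes "continuous_on ({0..1} \<times> UNIV) (\<lambda>(\<mu>, q). \<Lambda> \<mu> q)"
    and "a > 0" and "b > 0" and "c \<ge> 0"
    and "\<And>q. (SUP \<mu>\<in>{0..1}. norm (\<Lambda> \<mu> q)) \<le> a * exp (c * norm q)"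
    and "\<And>q q'. (SUP \<mu>\<in>{0..1}. norm (\<Lambda> \<mu> q - \<Lambda> \<mu> q'))
           \<le> b * exp (c * max (norm q) (norm q')) * norm (q - q')"
    and "c = 0 \<or> 2 * b < exp (- 2 * c * (norm q0 + a * exp (c * norm q0)))"
  shows "(\<exists>!q. solves_ivp \<Lambda> q0 q) \<and>
    (\<forall>q. solves_ivp \<Lambda> q0 q \<longrightarrow>
      (\<forall>\<mu>\<in>{0..1}. norm (q \<mu> - q0) \<le>
        (if c > 0 then 2 * \<mu> * a * exp (c * norm q0) else \<mu> * a * exp b)))"
proof -
  \<comment> \<open>\<open>B\<close> is both the speed bound and the radius of the ball, since the
    time interval has length \<open>1\<close>.\<close>
  define B where "B = (if c > 0 then 2 * (a * exp (c * norm q0)) else a)"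
  define L where "L r = b * exp (c * r)" for r
  have B: "B > 0" and L: "L r > 0" for r
    using \<open>a > 0\<close> \<open>b > 0\<close> by (auto simp: B_def L_def)
  have L_mono: "L r \<le> L s" if "r \<le> s" for r s
    using that \<open>b > 0\<close> \<open>c \<ge> 0\<close> by (simp add: L_def mult_left_mono)
  have cont: "continuous_on {0..1} (\<lambda>\<mu>. \<Lambda> \<mu> q)" for q
  proof -
    have "continuous_on {0..1} (\<lambda>\<mu>. (\<mu>, q))"
      by (intro continuous_intros)
    from continuous_on_compose2[OF assms(1) this] show ?thesis by auto
  qed
  have growth: "norm (\<Lambda> \<mu> q) \<le> a * exp (c * norm q)" if "\<mu> \<in> {0..1}" for \<mu> q
  proof -
    \<comment> \<open>A real supremum bounds its members only if the set is bounded above;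
      compactness of \<open>[0,1]\<close> ensures this.\<close>
    have "bdd_above ((\<lambda>\<mu>. norm (\<Lambda> \<mu> q)) ` {0..1})"
      by (intro bounded_imp_bdd_above compact_imp_bounded compact_continuous_image
          continuous_intros cont) auto
    from cSUP_upper[OF that this] assms(5)[of q] show ?thesis by linarith
  qed
  have lip: "norm (\<Lambda> \<mu> q - \<Lambda> \<mu> q') \<le> L r * norm (q - q')"
    if "\<mu> \<in> {0..1}" "norm q \<le> r" "norm q' \<le> r" for \<mu> q q' r
  proof -
    have "bdd_above ((\<lambda>\<mu>. norm (\<Lambda> \<mu> q - \<Lambda> \<mu> q')) ` {0..1})"
      by (intro bounded_imp_bdd_above compact_imp_bounded compact_continuous_image
          continuous_intros cont) auto
    from cSUP_upper[OF that(1) this] assms(6)[of q q']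
    have "norm (\<Lambda> \<mu> q - \<Lambda> \<mu> q') \<le> L (max (norm q) (norm q')) * norm (q - q')"
      unfolding L_def by linarith
    also have "\<dots> \<le> L r * norm (q - q')"
      using that by (intro mult_right_mono L_mono) auto
    finally show ?thesis .
  qed
  have ball: "norm q \<le> norm q0 + B" if "q \<in> cball q0 B" for q
    using that norm_triangle_sub[of q q0] by (simp add: dist_norm norm_minus_commute)
  have bound: "norm (\<Lambda> \<mu> q) \<le> B" if \<mu>: "\<mu> \<in> {0..1}" and q: "q \<in> cball q0 B" for \<mu> q
  proof (cases "c > 0")
    case True
    \<comment> \<open>The exponent on the left is \<open>c * norm q0 + c * B\<close>; adding another
      \<open>c * norm q0\<close> gives the one in the smallness condition.\<close>
    have "2 * L (norm q0 + B) \<le> 2 * b * exp (2 * c * (norm q0 + a * exp (c * norm q0)))"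
      using \<open>b > 0\<close> \<open>c \<ge> 0\<close> True by (simp add: L_def B_def algebra_simps)
    also have "\<dots> < 1"
      using assms(7) True exp_minus[of "2 * c * (norm q0 + a * exp (c * norm q0))"]
      by (simp add: less_divide_eq inverse_eq_divide)
    finally have L_half: "L (norm q0 + B) \<le> 1 / 2" by simp
    have "norm (\<Lambda> \<mu> q - \<Lambda> \<mu> q0) \<le> L (norm q0 + B) * norm (q - q0)"
      using ball[OF q] B by (intro lip[OF \<mu>]) auto
    also have "\<dots> \<le> 1 / 2 * B"
      using L_half q L[of "norm q0 + B"]
      by (intro mult_mono) (auto simp: dist_norm norm_minus_commute)
    finally have "norm (\<Lambda> \<mu> q - \<Lambda> \<mu> q0) \<le> a * exp (c * norm q0)"
      using True by (simp add: B_def)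
    then show ?thesis
      using growth[OF \<mu>, of q0] norm_triangle_sub[of "\<Lambda> \<mu> q" "\<Lambda> \<mu> q0"] True
      by (simp add: B_def)
  next
    case False
    then show ?thesis
      using growth[OF \<mu>, of q] \<open>c \<ge> 0\<close> by (simp add: B_def)
  qed
  obtain x where x: "x 0 = q0"
      "\<And>\<mu>. \<mu> \<in> {0..1} \<Longrightarrow> (x has_vector_derivative \<Lambda> \<mu> (x \<mu>)) (at \<mu> within {0..1})"
    and near: "\<And>\<mu>. \<mu> \<in> {0..1} \<Longrightarrow> norm (x \<mu> - q0) \<le> \<mu> * B"
  proof (rule ivp_exists_ball[of "L (norm q0 + B)" 1 B q0 \<Lambda>])
    show "continuous_on ({0..1} \<times> cball q0 (1 * B)) (\<lambda>(t, x). \<Lambda> t x)"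
      using assms(1) by (rule continuous_on_subset) auto
  qed (use L B lip ball bound in \<open>auto simp: less_imp_le\<close>)
  define q where "q = restrict x {0..1}"
  have q: "solves_ivp \<Lambda> q0 q"
    unfolding solves_ivp_def
  proof (intro conjI ballI)
    fix \<mu> :: real assume \<mu>: "\<mu> \<in> {0..1}"
    show "(q has_vector_derivative \<Lambda> \<mu> (q \<mu>)) (at \<mu> within {0..1})"
      using has_vector_derivative_transform[OF \<mu> _ x(2)[OF \<mu>], of q] \<mu> by (simp add: q_def)
  qed (use x in \<open>auto simp: q_def\<close>)
  have unique: "p = q" if p: "solves_ivp \<Lambda> q0 p" for p
  proof (rule extensionalityI)
    show "p \<in> extensional {0..1}" "q \<in> extensional {0..1}"
      using p q by (auto simp: solves_ivp_def PiE_def)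
    fix \<mu> :: real assume \<mu>: "\<mu> \<in> {0..1}"
    have p': "(p has_vector_derivative \<Lambda> \<mu> (p \<mu>)) (at \<mu> within {0..1})"
      and q': "(q has_vector_derivative \<Lambda> \<mu> (q \<mu>)) (at \<mu> within {0..1})"
      if "\<mu> \<in> {0..1}" for \<mu>
      using p q that by (auto simp: solves_ivp_def)
    \<comment> \<open>A competing solution \<open>p\<close> need not be confined to the ball
      beforehand: continuity on \<open>[0,1]\<close> bounds \<open>p\<close> and \<open>q\<close> by
      a common \<open>r\<close>, and \<open>L r\<close> is a Lipschitz constant along both.\<close>
    have "bounded (p ` {0..1} \<union> q ` {0..1})"
      unfolding bounded_Un
      by (intro conjI compact_imp_bounded compact_continuous_image
          continuous_on_vector_derivative[OF p'] continuous_on_vector_derivative[OF q']) auto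
    then obtain r where r: "\<And>\<mu>. \<mu> \<in> {0..1} \<Longrightarrow> norm (p \<mu>) \<le> r \<and> norm (q \<mu>) \<le> r"
      unfolding bounded_iff by blast
    show "p \<mu> = q \<mu>"
      using p q r by (intro ivp_unique[OF L p' q' lip[where r = r] _ \<mu>]) (auto simp: solves_ivp_def)
  qed
  have "norm (q \<mu> - q0) \<le>
      (if c > 0 then 2 * \<mu> * a * exp (c * norm q0) else \<mu> * a * exp b)" if \<mu>: "\<mu> \<in> {0..1}" for \<mu>
  proof -
    \<comment> \<open>For \<open>c = 0\<close> the ball argument yields the sharper bound
      \<open>\<mu> * a\<close>.\<close>
    have "\<mu> * a \<le> \<mu> * a * exp b"
      using mult_left_mono[of 1 "exp b" "\<mu> * a"] \<mu> \<open>a > 0\<close> \<open>b > 0\<close> by simp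
    moreover have "\<mu> * B = (if c > 0 then 2 * \<mu> * a * exp (c * norm q0) else \<mu> * a)"
      by (simp add: B_def)
    moreover have "norm (q \<mu> - q0) \<le> \<mu> * B"
      using near[OF \<mu>] \<mu> by (simp add: q_def)
    ultimately show ?thesis by (simp split: if_splits)
  qed
  with q unique show ?thesis by blast
qed

end
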